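(* Let $f(\bm{x})=\mathbb{E}_\xi[f(\bm{x};\xi)]$ on $\mathbb{R}^d$ be differentiable and $(L_0,L_1)$-smooth with respect to a positive semi-definite matrix $\bm{H}\in\mathbb{R}^{d\times d}$, let $f(\cdot;\xi)$ be twice differentiable with $\|\nabla^2f(\bm{x};\xi)\|\le\hat L$ for all $\bm{x}\in\mathcal{K}$ ($\mathcal{K}$ is the ball defined in the context), and let $\nu>0$ be the constant such that $\|\nabla f(\bm{x};\xi)-\nabla f(\bm{x})\|\le\nu$ for all $\bm{x}\in\mathbb{R}^d$. Let $\bm{S}_t\in\mathbb{R}^{d\times\ell}$, with columns $\bm{s}_1,\dots,\bm{s}_\ell$, be an oblivious $(\frac14,k,\delta)$-random sketching matrix with $k\ge4$ and $\delta\in(0,1)$. Assume that $\beta=\frac{\alpha\nu}{4\sqrt{\ell-1}}$ and $\alpha^2\le\frac{\nu^2}{8\hat L^2\hat\zeta_1}$ with $\alpha>0$ and $\hat\zeta_1=\left(\frac{5\ell}{4}+\frac{d\ell}{4k}\right)^2$. Conditioned on the event $\hat{\mathcal{E}}_{t,3}$ (defined in the context), it holds that $$\sigma_t+\beta\ge\sqrt{\frac{\alpha^2}{8(\ell-1)}\|\nabla f(\bm{x}_t;\xi_t)\|^2+\frac{\beta^2}{2}}$$ and $$\sigma_t\le\frac{3\alpha}{2\sqrt{\ell-1}}\|\nabla f(\bm{x}_t;\xi_t)\|+\sqrt{\frac{3\alpha^4\hat L^2\hat\zeta_1}{4(\ell-1)}}.$$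
   Context: $\|\cdot\|$ is the Euclidean norm of vectors and the spectral norm of matrices, $\|\cdot\|_F$ the Frobenius norm; $\|\bm{x}\|_{\bm{H}}=\sqrt{\bm{x}^\top\bm{H}\bm{x}}$. $(L_0,L_1)$-smoothness w.r.t. $\bm{H}$: for all $\bm{x},\bm{y}\in\mathbb{R}^d$ with $\|\bm{y}-\bm{x}\|_{\bm{H}}\le 1/(L_1\sqrt{\|\bm{H}\|})$, $\big|f(\bm{y})-f(\bm{x})-\langle\nabla f(\bm{x}),\bm{y}-\bm{x}\rangle\big|\le\frac{L_0+L_1\|\nabla f(\bm{x})\|}{2}\|\bm{y}-\bm{x}\|_{\bm{H}}^2$. Oblivious $(\gamma,k,\delta)$-random sketching matrix: given a matrix $\bm{A}\in\mathbb{R}^{d\times d}$, a random $\bm{S}\in\mathbb{R}^{d\times\ell}$ independent of $\bm{A}$ such that, with probability at least $1-\delta$, $\|\bm{A}^\top\bm{S}\bm{S}^\top\bm{A}-\bm{A}^\top\bm{A}\|\le\gamma(\|\bm{A}\|^2+\|\bm{A}\|_F^2/k)$. $\mathcal{K}=\big\{\bm{x}:\|\bm{x}-\bm{x}_0\|\le\frac{3\sqrt T}{350L_1\sqrt{\zeta_2}}\big\}$, where $\bm{x}_0$ is the initial point and $T$ the total number of iterations of the stochastic adaptive zeroth-order method, and $\zeta_2=\frac{5\|\bm{H}\|}{4}+\frac{\mathrm{tr}(\bm{H})}{4k}$. Stochastic adaptive zeroth-order method: at iterate $\bm{x}_t$ draw $\xi_t$ and $\bm{S}_t$; with $\hat{\mathbf{g}}(\bm{x}_t)=\sum_{i=1}^\ell\frac{f(\bm{x}_t+\alpha\bm{s}_i;\xi_t)-f(\bm{x}_t;\xi_t)}{\alpha}\bm{s}_i$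 and $\sigma_t=\sqrt{\frac{1}{\ell-1}\sum_{j=1}^\ell\big(f(\bm{x}_t+\alpha\bm{s}_j;\xi_t)-\frac1\ell\sum_{i=1}^\ell f(\bm{x}_t+\alpha\bm{s}_i;\xi_t)\big)^2}$, update $\bm{x}_{t+1}=\bm{x}_t-\eta\,\hat{\mathbf{g}}(\bm{x}_t)/(\sigma_t+\beta)$ with step size $\eta>0$. Event $\hat{\mathcal{E}}_{t,3}$: $\frac1\ell\big(\sum_{i=1}^\ell\langle\nabla f(\bm{x}_t;\xi_t),\bm{s}_i\rangle\big)^2\le\frac14\|\nabla f(\bm{x}_t;\xi_t)\|^2$.
   Formalization: The inequalities are claimed on the part of the event where the sketch is accurate for both I and gg^T, g=∇f(x_t;ξ_t) (probability shown ≥ 1−2δ), and where x_t and all x_t+αs_i lie in K; on the event alone they can fail (S_t=0 on sketch failure, or large Hessian outside K). *)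

theory Defs
  imports "HOL-Probability.Probability"
begin

section \<open>Matrices and derivatives\<close>

text \<open>The type \<open>real ^ 'l ^ 'd\<close> has rows indexed by \<open>'d\<close> and columns by \<open>'l\<close>.
  The library norm of that type is the Euclidean norm of all entries, that is, the Frobenius norm.\<close>

definition spectral_norm :: "real ^ 'n ^ 'm \<Rightarrow> real" where
  "spectral_norm A = onorm (\<lambda>v. A *v v)"

definition pos_semidef :: "real ^ 'n ^ 'n \<Rightarrow> bool" where
  "pos_semidef H \<longleftrightarrow> transpose H = H \<and> (\<forall>v. 0 \<le> v \<bullet> (H *v v))"

definition weighted_norm :: "real ^ 'n ^ 'n \<Rightarrow> real ^ 'n \<Rightarrow> real" where
  "weighted_norm H v = sqrt (v \<bullet> (H *v v))"

definition grad :: "(real ^ 'n \<Rightarrow> real) \<Rightarrow> real ^ 'n \<Rightarrow> real ^ 'n" where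
  "grad f x = (THE g. GDERIV f x :> g)"

definition hessian :: "(real ^ 'n \<Rightarrow> real) \<Rightarrow> real ^ 'n \<Rightarrow> real ^ 'n ^ 'n" where
  "hessian f x = matrix (frechet_derivative (grad f) (at x))"

definition twice_differentiable_at :: "(real ^ 'n \<Rightarrow> real) \<Rightarrow> real ^ 'n \<Rightarrow> bool" where
  "twice_differentiable_at f x \<longleftrightarrow>
     (\<forall>\<^sub>F y in nhds x. f differentiable (at y)) \<and> grad f differentiable (at x)"

definition outer_prod :: "real ^ 'm \<Rightarrow> real ^ 'n \<Rightarrow> real ^ 'n ^ 'm" where
  "outer_prod u v = (\<chi> i j. u $ i * v $ j)"

text \<open>For \<open>H = 0\<close> both sides of the radius condition below are \<open>0\<close>,
  so the condition then holds for all \<open>x\<close> and \<open>y\<close>, in line with an infinite radius.\<close>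

definition L0_L1_smooth ::
    "real \<Rightarrow> real \<Rightarrow> real ^ 'n ^ 'n \<Rightarrow> (real ^ 'n \<Rightarrow> real) \<Rightarrow> bool" where
  "L0_L1_smooth L0 L1 H f \<longleftrightarrow>
     (\<forall>x y. weighted_norm H (y - x) \<le> 1 / (L1 * sqrt (spectral_norm H)) \<longrightarrow>
        \<bar>f y - f x - grad f x \<bullet> (y - x)\<bar>
          \<le> (L0 + L1 * norm (grad f x)) / 2 * (weighted_norm H (y - x))\<^sup>2)"

section \<open>Random sketching\<close>

definition sketch_accurate ::
    "real \<Rightarrow> real \<Rightarrow> real ^ 'd ^ 'd \<Rightarrow> real ^ 'l ^ 'd \<Rightarrow> bool" where
  "sketch_accurate \<gamma> k A S \<longleftrightarrow>
     spectral_norm (transpose A ** S ** transpose S ** A - transpose A ** A)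
       \<le> \<gamma> * ((spectral_norm A)\<^sup>2 + (norm A)\<^sup>2 / k)"

text \<open>Obliviousness: the law of \<open>S\<close> does not depend on \<open>A\<close>, and the accuracy bound
  is required for every deterministic \<open>A\<close>. For a random \<open>A\<close> independent of \<open>S\<close> the same bound
  follows by conditioning on \<open>A\<close>.\<close>

definition oblivious_sketching ::
    "'w measure \<Rightarrow> real \<Rightarrow> real \<Rightarrow> real \<Rightarrow> ('w \<Rightarrow> real ^ 'l ^ 'd) \<Rightarrow> bool" where
  "oblivious_sketching M \<gamma> k \<delta> S \<longleftrightarrow>
     S \<in> borel_measurable M \<and>
     (\<forall>A :: real ^ 'd ^ 'd. measure M {w \<in> space M. sketch_accurate \<gamma> k A (S w)} \<ge> 1 - \<delta>)"

text \<open>Independence of two random variables with different value types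
  (\<^const>\<open>prob_space.indep_var\<close> requires equal types).\<close>

definition indep_rv ::
    "'w measure \<Rightarrow> 'a measure \<Rightarrow> ('w \<Rightarrow> 'a) \<Rightarrow> 'b measure \<Rightarrow> ('w \<Rightarrow> 'b) \<Rightarrow> bool" where
  "indep_rv M N X N' Y \<longleftrightarrow>
     X \<in> measurable M N \<and> Y \<in> measurable M N' \<and>
     prob_space.indep_set M {X -` A \<inter> space M | A. A \<in> sets N} {Y -` B \<inter> space M | B. B \<in> sets N'}"

section \<open>The stochastic adaptive zeroth-order method\<close>

text \<open>Below \<open>F x z\<close> is the sampled objective at the point \<open>x\<close> with sample \<open>z\<close>.\<close>

definition zo_grad ::
    "(real ^ 'd \<Rightarrow> 'z \<Rightarrow> real) \<Rightarrow> real \<Rightarrow> real ^ 'd \<Rightarrow> 'z \<Rightarrow> real ^ 'l ^ 'd \<Rightarrow> real ^ 'd" where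
  "zo_grad F \<alpha> x z S =
     (\<Sum>i\<in>UNIV. ((F (x + \<alpha> *\<^sub>R column i S) z - F x z) / \<alpha>) *\<^sub>R column i S)"

definition zo_sigma ::
    "(real ^ 'd \<Rightarrow> 'z \<Rightarrow> real) \<Rightarrow> real \<Rightarrow> real ^ 'd \<Rightarrow> 'z \<Rightarrow> real ^ 'l ^ 'd \<Rightarrow> real" where
  "zo_sigma F \<alpha> x z S =
     sqrt (1 / (real CARD('l) - 1) *
       (\<Sum>j\<in>UNIV. (F (x + \<alpha> *\<^sub>R column j S) z
                    - 1 / real CARD('l) * (\<Sum>i\<in>UNIV. F (x + \<alpha> *\<^sub>R column i S) z))\<^sup>2))"

primrec zo_iterate ::
    "(real ^ 'd \<Rightarrow> 'z \<Rightarrow> real) \<Rightarrow> real \<Rightarrow> real \<Rightarrow> real \<Rightarrow> real ^ 'd \<Rightarrow>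
     (nat \<Rightarrow> 'z) \<Rightarrow> (nat \<Rightarrow> real ^ 'l ^ 'd) \<Rightarrow> nat \<Rightarrow> real ^ 'd" where
  "zo_iterate F \<alpha> \<beta> \<eta> x0 z S 0 = x0"
| "zo_iterate F \<alpha> \<beta> \<eta> x0 z S (Suc t) =
     (let x = zo_iterate F \<alpha> \<beta> \<eta> x0 z S t
      in x - (\<eta> / (zo_sigma F \<alpha> x (z t) (S t) + \<beta>)) *\<^sub>R zo_grad F \<alpha> x (z t) (S t))"

definition zeta2 :: "real ^ 'd ^ 'd \<Rightarrow> real \<Rightarrow> real" where
  "zeta2 H k = 5 * spectral_norm H / 4 + trace H / (4 * k)"

definition zeta1_hat :: "real \<Rightarrow> real \<Rightarrow> real \<Rightarrow> real" where
  "zeta1_hat d l k = (5 * l / 4 + d * l / (4 * k))\<^sup>2"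

text \<open>For \<open>H = 0\<close> the radius is a division by zero and the set is \<open>{x0}\<close>.\<close>

definition K_ball :: "real ^ 'd \<Rightarrow> nat \<Rightarrow> real \<Rightarrow> real ^ 'd ^ 'd \<Rightarrow> real \<Rightarrow> (real ^ 'd) set" where
  "K_ball x0 T L1 H k = {x. norm (x - x0) \<le> 3 * sqrt (real T) / (350 * L1 * sqrt (zeta2 H k))}"

text \<open>The defining condition of the event on which the lemma is conditioned,
  with \<open>g\<close> the sampled gradient at the current iterate.\<close>

definition event_E3 :: "real ^ 'd \<Rightarrow> real ^ 'l ^ 'd \<Rightarrow> bool" where
  "event_E3 g S \<longleftrightarrow>
     1 / real CARD('l) * (\<Sum>i\<in>UNIV. g \<bullet> column i S)\<^sup>2 \<le> 1 / 4 * (norm g)\<^sup>2"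

end

theory Submission
  imports Defs
begin

text \<open>Write \<open>g\<close> for the sampled gradient, \<open>a\<^sub>i = g \<bullet> s\<^sub>i\<close>, and \<open>r\<^sub>i\<close> for the second-order Taylor remainder,
  so that the sampled values are \<open>F x z + \<alpha> a\<^sub>i + r\<^sub>i\<close>. Up to the factor \<open>1 / (l - 1)\<close>, \<open>\<sigma>\<^sup>2\<close> is the squared length
  of the centred vector \<open>\<alpha> P a + P r\<close>, where \<open>P\<close> removes the mean. Sketching accuracy for the
  rank-one matrix \<open>g g\<^sup>T\<close> (with \<open>k \<ge> 4\<close>) puts \<open>|a|\<^sup>2\<close> within \<open>5/16 |g|\<^sup>2\<close> of \<open>|g|\<^sup>2\<close>,
  and the conditioning event says that centring costs at most \<open>1/4 |g|\<^sup>2\<close>. Sketching accuracy for the identity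
  bounds every \<open>s\<^sub>i\<close>, hence \<open>r\<close>, and the condition on \<open>\<alpha>\<close> bounds the length of \<open>r\<close> by \<open>sqrt ((l - 1) / 2) * \<beta>\<close>.
  Both accuracy events have probability at least \<open>1 - \<delta>\<close>; for the random matrix \<open>g g\<^sup>T\<close> this is
  Fubini, since \<open>g\<close> is a measurable function of the iterate and the sample.\<close>

section \<open>Gradients\<close>

lemma GDERIV_unique:
  assumes "GDERIV f x :> a" "GDERIV f x :> b"
  shows "a = b"
proof -
  have "(\<lambda>h. inner h a) = (\<lambda>h. inner h b)"
    using assms unfolding gderiv_def by (rule has_derivative_unique)
  then have "inner (a - b) a = inner (a - b) b" by metis
  then have "inner (a - b) (a - b) = 0" by (simp add: inner_diff_right)
  then show ?thesis by simp
qed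

text \<open>Riesz representation in coordinates: the values of the derivative on the basis are the
  coordinates of a gradient vector. With existence and uniqueness settled, the definite description
  in \<open>grad\<close> denotes that vector.\<close>

lemma GDERIV_grad:
  fixes f :: "real ^ 'n \<Rightarrow> real"
  assumes "f differentiable (at x)"
  shows "GDERIV f x :> grad f x"
proof -
  obtain f' where f': "(f has_derivative f') (at x)"
    using assms unfolding differentiable_def by blast
  interpret f': linear f' using f' by (rule has_derivative_linear)
  have "f' h = h \<bullet> (\<Sum>b\<in>Basis. f' b *\<^sub>R b)" for h
  proof -
    have "f' h = f' (\<Sum>b\<in>Basis. (h \<bullet> b) *\<^sub>R b)"
      by (simp add: euclidean_representation)
    also have "\<dots> = (\<Sum>b\<in>Basis. (h \<bullet> b) * f' b)"
      by (simp add: f'.sum f'.scale)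
    finally show ?thesis by (simp add: inner_sum_right mult.commute)
  qed
  then have "f' = (\<lambda>h. h \<bullet> (\<Sum>b\<in>Basis. f' b *\<^sub>R b))" by blast
  then have "GDERIV f x :> (\<Sum>b\<in>Basis. f' b *\<^sub>R b)"
    using f' unfolding gderiv_def by simp
  then show ?thesis
    unfolding grad_def by (rule theI) (rule GDERIV_unique[OF _ \<open>GDERIV f x :> (\<Sum>b\<in>Basis. f' b *\<^sub>R b)\<close>])
qed

lemma GDERIV_line:
  assumes "GDERIV f (x + t *\<^sub>R v) :> D"
  shows "((\<lambda>t. f (x + t *\<^sub>R v)) has_real_derivative v \<bullet> D) (at t)"
proof -
  have "((\<lambda>t. x + t *\<^sub>R v) has_derivative (\<lambda>h. h *\<^sub>R v)) (at t)"
    by (auto intro!: derivative_eq_intros)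
  from has_derivative_compose[OF this assms[unfolded gderiv_def]]
  show ?thesis by (simp add: has_field_derivative_def mult_commute_abs)
qed

text \<open>A limit along a sequence, rather than along real increments, is what lets measurability
  of function values pass to the gradient.\<close>

lemma grad_nth_LIMSEQ:
  fixes f :: "real ^ 'n \<Rightarrow> real"
  assumes "f differentiable (at x)"
  shows "(\<lambda>n. (f (x + inverse (real (Suc n)) *\<^sub>R axis i 1) - f x) * real (Suc n))
           \<longlonglongrightarrow> grad f x $ i"
proof -
  have "((\<lambda>t. f (x + t *\<^sub>R axis i 1)) has_real_derivative axis i 1 \<bullet> grad f x) (at 0)"
    by (rule GDERIV_line) (use GDERIV_grad[OF assms] in simp)
  then have lim: "((\<lambda>h. (f (x + h *\<^sub>R axis i 1) - f x) / h) \<longlongrightarrow> grad f x $ i) (at 0)"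
    unfolding DERIV_def by (simp add: inner_axis')
  have "filterlim (\<lambda>n. inverse (real (Suc n))) (at 0) sequentially"
    by (rule filterlim_atI[OF LIMSEQ_inverse_real_of_nat]) simp
  from filterlim_compose[OF lim this] show ?thesis
    by (simp add: divide_inverse)
qed

section \<open>Second-order Taylor estimate\<close>

lemma abs_inner_matrix_le:
  "\<bar>u \<bullet> (A *v v)\<bar> \<le> spectral_norm A * norm u * norm v"
  for A :: "real ^ 'n ^ 'm"
proof -
  have "\<bar>u \<bullet> (A *v v)\<bar> \<le> norm u * norm (A *v v)"
    by (rule Cauchy_Schwarz_ineq2)
  also have "\<dots> \<le> norm u * (spectral_norm A * norm v)"
    unfolding spectral_norm_def
    by (intro mult_left_mono onorm) (simp_all add: matrix_vector_mul_bounded_linear)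
  finally show ?thesis by (simp add: ac_simps)
qed

text \<open>Taylor expansion with Lagrange remainder along the segment from \<open>x\<close> to
  \<open>x + v\<close>: the remainder is half the Hessian form at one intermediate point. This form
  asks only for existence of the second derivative, not for its continuity.\<close>

lemma second_order_taylor_bound:
  fixes f :: "real ^ 'n \<Rightarrow> real"
  assumes diff: "\<And>s. 0 \<le> s \<Longrightarrow> s \<le> 1 \<Longrightarrow> twice_differentiable_at f (x + s *\<^sub>R v)"
    and hess: "\<And>s. 0 \<le> s \<Longrightarrow> s \<le> 1 \<Longrightarrow> spectral_norm (hessian f (x + s *\<^sub>R v)) \<le> L"
  shows "\<bar>f (x + v) - f x - grad f x \<bullet> v\<bar> \<le> L / 2 * (norm v)\<^sup>2"
proof -
  \<comment> \<open>The restriction to the line and its first two derivatives, indexed by order as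
    \<open>Maclaurin\<close> expects them.\<close>
  define \<phi> :: "nat \<Rightarrow> real \<Rightarrow> real" where "\<phi> m s = (if m = 0 then f (x + s *\<^sub>R v)
      else if m = 1 then v \<bullet> grad f (x + s *\<^sub>R v)
      else v \<bullet> (hessian f (x + s *\<^sub>R v) *v v))" for m s
  have "(\<phi> m has_real_derivative \<phi> (Suc m) s) (at s)" if "m < 2" "0 \<le> s" "s \<le> 1" for m s
  proof -
    note tw = diff[OF that(2,3), unfolded twice_differentiable_at_def]
    have "f differentiable (at (x + s *\<^sub>R v))"
      using tw eventually_nhds_x_imp_x by blast
    then have 0: "(\<phi> 0 has_real_derivative \<phi> (Suc 0) s) (at s)"
      unfolding \<phi>_def by (simp add: GDERIV_line[OF GDERIV_grad])
    let ?D = "frechet_derivative (grad f) (at (x + s *\<^sub>R v))"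
    have D: "(grad f has_derivative ?D) (at (x + s *\<^sub>R v))"
      using tw frechet_derivative_works by blast
    have line: "((\<lambda>t. x + t *\<^sub>R v) has_derivative (\<lambda>h. h *\<^sub>R v)) (at s)"
      by (auto intro!: derivative_eq_intros)
    have hv: "hessian f (x + s *\<^sub>R v) *v h = ?D h" for h
      unfolding hessian_def by (rule matrix_works) (use has_derivative_linear[OF D] in \<open>simp add: linear_matrix_vector_mul_eq\<close>)
    have "((\<lambda>t. v \<bullet> grad f (x + t *\<^sub>R v)) has_derivative (\<lambda>h. v \<bullet> ?D (h *\<^sub>R v))) (at s)"
      by (rule has_derivative_inner_right[OF has_derivative_compose[OF line D]])
    then have "(\<phi> (Suc 0) has_real_derivative \<phi> (Suc (Suc 0)) s) (at s)"
      unfolding \<phi>_def has_field_derivative_def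
      by (simp add: hv[symmetric] matrix_vector_mult_scaleR mult_commute_abs)
    with 0 that(1) show ?thesis by (cases m) (auto simp: less_Suc_eq numeral_2_eq_2)
  qed
  then obtain s where s: "0 < s" "s < 1"
    and eq: "\<phi> 0 1 = (\<Sum>m<2. \<phi> m 0 / fact m * 1 ^ m) + \<phi> 2 s / fact 2 * 1 ^ 2"
    using Maclaurin[of 1 2 \<phi> "\<phi> 0"] by auto
  have "f (x + v) - f x - grad f x \<bullet> v = (v \<bullet> (hessian f (x + s *\<^sub>R v) *v v)) / 2"
    using eq by (simp add: \<phi>_def numeral_2_eq_2 inner_commute)
  also have "\<bar>\<dots>\<bar> \<le> (spectral_norm (hessian f (x + s *\<^sub>R v)) * norm v * norm v) / 2"
    using abs_inner_matrix_le[of v "hessian f (x + s *\<^sub>R v)" v] by simp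
  also have "\<dots> \<le> (L * norm v * norm v) / 2"
    using hess[of s] s by (intro divide_right_mono mult_right_mono) auto
  finally show ?thesis by (simp add: power2_eq_square)
qed

section \<open>Measurability and independence\<close>

text \<open>Approximating \<open>X\<close> by simple functions reduces joint measurability to finitely many sections.\<close>

lemma measurable_caratheodory:
  fixes F :: "'a :: {metric_space, second_countable_topology} \<Rightarrow> 'z \<Rightarrow> 'b :: metric_space"
  assumes X: "X \<in> borel_measurable M" and Y: "Y \<in> measurable M D"
    and F: "\<And>u. F u \<in> borel_measurable D"
    and cont: "\<And>z. z \<in> space D \<Longrightarrow> continuous_on UNIV (\<lambda>u. F u z)"
  shows "(\<lambda>w. F (X w) (Y w)) \<in> borel_measurable M"
proof -
  from borel_measurable_implies_sequence_metric[OF X] obtain q where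
    q: "\<And>i. simple_function M (q i)" "\<And>w. w \<in> space M \<Longrightarrow> (\<lambda>i. q i w) \<longlonglongrightarrow> X w"
    by blast
  show ?thesis
  proof (rule borel_measurable_LIMSEQ_metric)
    fix i
    show "(\<lambda>w. F (q i w) (Y w)) \<in> borel_measurable M"
    proof (rule measurable_compose_countable'[where f = "\<lambda>u w. F u (Y w)" and g = "q i"])
      show "countable (q i ` space M)"
        using simple_functionD(1)[OF q(1)] by (rule countable_finite)
      show "q i \<in> measurable M (count_space (q i ` space M))"
        using q(1) by (simp add: simple_function_def measurable_count_space_eq2)
    qed (use F Y in measurable)
  next
    fix w assume w: "w \<in> space M"
    then have "isCont (\<lambda>u. F u (Y w)) (X w)"
      using cont[of "Y w"] measurable_space[OF Y] by (simp add: continuous_on_eq_continuous_at)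
    then show "(\<lambda>i. F (q i w) (Y w)) \<longlonglongrightarrow> F (X w) (Y w)"
      using q(2)[OF w] by (rule isCont_tendsto_compose)
  qed
qed

text \<open>Differentiability gives continuity in the point, so shifted function values are jointly
  measurable although only the sections \<open>F u\<close> are assumed so; each gradient coordinate
  is a limit of their difference quotients.\<close>

lemma measurable_grad:
  fixes F :: "real ^ 'n \<Rightarrow> 'z \<Rightarrow> real"
  assumes X: "X \<in> borel_measurable M" and Y: "Y \<in> measurable M D"
    and F: "\<And>u. F u \<in> borel_measurable D"
    and diff: "\<And>u z. z \<in> space D \<Longrightarrow> (\<lambda>u. F u z) differentiable (at u)"
  shows "(\<lambda>w. grad (\<lambda>u. F u (Y w)) (X w)) \<in> borel_measurable M"
proof -
  have cont: "continuous_on UNIV (\<lambda>u. F u z)" if "z \<in> space D" for z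
    using diff[OF that] by (simp add: differentiable_imp_continuous_within continuous_at_imp_continuous_on)
  have FX: "(\<lambda>w. F (X w + c) (Y w)) \<in> borel_measurable M" for c
    by (rule measurable_caratheodory[OF _ Y F cont]) (use X in measurable)
  have nth: "(\<lambda>w. grad (\<lambda>u. F u (Y w)) (X w) $ i) \<in> borel_measurable M" for i
  proof (rule borel_measurable_LIMSEQ_metric)
    fix n
    show "(\<lambda>w. (F (X w + inverse (real (Suc n)) *\<^sub>R axis i 1) (Y w) - F (X w) (Y w)) * real (Suc n))
            \<in> borel_measurable M"
      using FX[of "inverse (real (Suc n)) *\<^sub>R axis i 1"] FX[of 0] by simp
  next
    fix w assume "w \<in> space M"
    then show "(\<lambda>n. (F (X w + inverse (real (Suc n)) *\<^sub>R axis i 1) (Y w) - F (X w) (Y w)) * real (Suc n))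
            \<longlonglongrightarrow> grad (\<lambda>u. F u (Y w)) (X w) $ i"
      by (intro grad_nth_LIMSEQ diff) (rule measurable_space[OF Y])
  qed
  show ?thesis
    by (subst borel_measurable_euclidean_space) (use nth in \<open>auto simp: Basis_vec_def inner_axis\<close>)
qed

section \<open>Independence as a product law, and Fubini\<close>

text \<open>Independence is exactly agreement of the two measures on rectangles, and sigma-finite
  measures that agree on rectangles coincide.\<close>

lemma indep_rv_distr_pair:
  assumes "prob_space M" and indep: "indep_rv M N X N' Y"
  shows "distr M N X \<Otimes>\<^sub>M distr M N' Y = distr M (N \<Otimes>\<^sub>M N') (\<lambda>w. (X w, Y w))"
proof -
  interpret prob_space M by fact
  have X: "X \<in> measurable M N" and Y: "Y \<in> measurable M N'"
    and ind: "indep_set {X -` A \<inter> space M | A. A \<in> sets N} {Y -` B \<inter> space M | B. B \<in> sets N'}"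
    using indep unfolding indep_rv_def by auto
  have XY: "(\<lambda>w. (X w, Y w)) \<in> measurable M (N \<Otimes>\<^sub>M N')"
    using X Y by measurable
  interpret X: prob_space "distr M N X" by (rule prob_space_distr[OF X])
  interpret Y: prob_space "distr M N' Y" by (rule prob_space_distr[OF Y])
  show ?thesis
  proof (rule pair_measure_eqI)
    fix A B assume A: "A \<in> sets (distr M N X)" and B: "B \<in> sets (distr M N' Y)"
    let ?A = "X -` A \<inter> space M" and ?B = "Y -` B \<inter> space M"
    have "prob (?A \<inter> ?B) = prob ?A * prob ?B"
      by (rule indep_setD[OF ind]) (use A B in auto)
    moreover have "(\<lambda>w. (X w, Y w)) -` (A \<times> B) \<inter> space M = ?A \<inter> ?B" by auto
    ultimately show "emeasure (distr M N X) A * emeasure (distr M N' Y) B =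
        emeasure (distr M (N \<Otimes>\<^sub>M N') (\<lambda>w. (X w, Y w))) (A \<times> B)"
      using A B by (simp add: emeasure_distr X Y XY pair_measureI emeasure_eq_measure ennreal_mult)
  qed (auto intro!: X.sigma_finite_measure_axioms Y.sigma_finite_measure_axioms
        sets_pair_measure_cong)
qed

text \<open>Fubini over the product law: a probability bound valid for each frozen value
  \<open>a\<close> of \<open>X\<close> survives integration over the law of \<open>X\<close>. This
  carries the sketching guarantee from deterministic matrices to random ones.\<close>

lemma indep_rv_measure_ge:
  assumes "prob_space M" and indep: "indep_rv M N X N' Y"
    and Q: "Q \<in> sets (N \<Otimes>\<^sub>M N')"
    and c: "\<And>a. a \<in> space N \<Longrightarrow> c \<le> measure M {w \<in> space M. (a, Y w) \<in> Q}"
  shows "c \<le> measure M {w \<in> space M. (X w, Y w) \<in> Q}"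
proof -
  interpret prob_space M by fact
  have X: "X \<in> measurable M N" and Y: "Y \<in> measurable M N'"
    using indep unfolding indep_rv_def by auto
  have XY: "(\<lambda>w. (X w, Y w)) \<in> measurable M (N \<Otimes>\<^sub>M N')"
    using X Y by measurable
  interpret X: prob_space "distr M N X" by (rule prob_space_distr[OF X])
  interpret Y: prob_space "distr M N' Y" by (rule prob_space_distr[OF Y])
  have Q': "Q \<in> sets (distr M N X \<Otimes>\<^sub>M distr M N' Y)"
    using Q by (simp cong: sets_pair_measure_cong)
  have "ennreal c = (\<integral>\<^sup>+a. ennreal c \<partial>distr M N X)"
    using X.emeasure_space_1 by simp
  also have "\<dots> \<le> (\<integral>\<^sup>+a. emeasure (distr M N' Y) (Pair a -` Q) \<partial>distr M N X)"
  proof (rule nn_integral_mono)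
    fix a assume "a \<in> space (distr M N X)"
    then have "c \<le> measure M {w \<in> space M. (a, Y w) \<in> Q}"
      by (intro c) simp
    moreover have "emeasure (distr M N' Y) (Pair a -` Q) = ennreal (measure M {w \<in> space M. (a, Y w) \<in> Q})"
      using Y sets_Pair1[OF Q, of a]
      by (simp add: emeasure_distr emeasure_eq_measure vimage_def Int_def conj_commute)
    ultimately show "ennreal c \<le> emeasure (distr M N' Y) (Pair a -` Q)"
      by (simp add: ennreal_leI)
  qed
  also have "\<dots> = emeasure (distr M (N \<Otimes>\<^sub>M N') (\<lambda>w. (X w, Y w))) Q"
    by (simp add: Y.emeasure_pair_measure_alt[OF Q'] flip: indep_rv_distr_pair[OF \<open>prob_space M\<close> indep])
  also have "\<dots> = ennreal (measure M {w \<in> space M. (X w, Y w) \<in> Q})"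
    using XY Q by (simp add: emeasure_distr emeasure_eq_measure vimage_def Int_def conj_commute)
  finally show ?thesis
    by (simp add: ennreal_le_iff)
qed

section \<open>Spectral norm and sketching\<close>

text \<open>Cauchy-Schwarz in each row; \<open>norm A\<close> is the Frobenius norm.\<close>

lemma norm_matrix_vector_mult_le: "norm (A *v x) \<le> norm A * norm x"
  for A :: "real ^ 'n ^ 'm"
proof -
  have "norm (A *v x) = L2_set (\<lambda>i. \<bar>A $ i \<bullet> x\<bar>) UNIV"
    by (simp add: norm_vec_def matrix_vector_mul_component)
  also have "\<dots> \<le> L2_set (\<lambda>i. norm (A $ i) * norm x) UNIV"
    by (intro L2_set_mono Cauchy_Schwarz_ineq2) auto
  also have "\<dots> = norm A * norm x"
    by (simp add: norm_vec_def L2_set_left_distrib)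
  finally show ?thesis .
qed

lemma spectral_norm_le_norm: "spectral_norm A \<le> norm A"
  unfolding spectral_norm_def by (rule onorm_bound) (auto intro: norm_matrix_vector_mult_le)

lemma spectral_norm_diff_le: "spectral_norm A - spectral_norm B \<le> norm (A - B)"
  for A B :: "real ^ 'n ^ 'm"
proof -
  have "spectral_norm A = onorm (\<lambda>v. (A - B) *v v + B *v v)"
    by (simp add: spectral_norm_def matrix_vector_mult_diff_rdistrib)
  also have "\<dots> \<le> spectral_norm (A - B) + spectral_norm B"
    unfolding spectral_norm_def by (rule onorm_triangle) auto
  finally show ?thesis using spectral_norm_le_norm[of "A - B"] by simp
qed

text \<open>The triangle inequality makes the spectral norm 1-Lipschitz for the Frobenius norm.
  Continuity serves to show that accuracy of a sketch is a measurable event.\<close>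

lemma continuous_on_spectral_norm: "continuous_on UNIV (spectral_norm :: real ^ 'n ^ 'm \<Rightarrow> real)"
proof (rule continuous_onI)
  fix A :: "real ^ 'n ^ 'm" and e :: real assume "0 < e"
  have "dist (spectral_norm B) (spectral_norm A) \<le> dist B A" for B :: "real ^ 'n ^ 'm"
    using spectral_norm_diff_le[of A B] spectral_norm_diff_le[of B A]
    by (simp add: dist_norm norm_minus_commute abs_le_iff)
  then show "\<exists>d>0. \<forall>B\<in>UNIV. dist B A < d \<longrightarrow> dist (spectral_norm B) (spectral_norm A) \<le> e"
    using \<open>0 < e\<close> by (meson less_imp_le order_trans)
qed

lemma spectral_norm_mat_1_le: "spectral_norm (mat 1 :: real ^ 'n ^ 'n) \<le> 1"
  unfolding spectral_norm_def by (rule onorm_bound) auto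

lemma norm_mat_1_power2: "(norm (mat 1 :: real ^ 'n ^ 'n))\<^sup>2 = real CARD('n)"
  by (simp add: power2_norm_eq_inner inner_vec_def mat_def if_distrib if_distribR cong: if_cong)

lemma outer_prod_mult_vec: "outer_prod u v *v w = (v \<bullet> w) *\<^sub>R u"
  by (simp add: vec_eq_iff outer_prod_def matrix_vector_mult_def inner_vec_def sum_distrib_left
      sum_distrib_right ac_simps)

lemma norm_outer_prod: "norm (outer_prod u v) = norm u * norm v"
proof -
  have "(norm (outer_prod u v))\<^sup>2 = (norm u * norm v)\<^sup>2"
    unfolding power_mult_distrib power2_norm_eq_inner inner_vec_def outer_prod_def sum_product
    by (simp add: ac_simps)
  then show ?thesis by (simp add: power2_eq_iff_nonneg)
qed

text \<open>The operator bound is tested on \<open>u\<close>: moving the transposes across the inner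
  product turns the quadratic form into the squared length of \<open>transpose S *v (A *v u)\<close>
  minus that of \<open>A *v u\<close>.\<close>

lemma sketch_accurate_form:
  fixes A :: "real ^ 'd ^ 'd" and S :: "real ^ 'l ^ 'd"
  assumes "sketch_accurate \<gamma> k A S"
  shows "\<bar>(\<Sum>i\<in>UNIV. ((A *v u) \<bullet> column i S)\<^sup>2) - (norm (A *v u))\<^sup>2\<bar>
           \<le> \<gamma> * ((spectral_norm A)\<^sup>2 + (norm A)\<^sup>2 / k) * (norm u)\<^sup>2"
proof -
  let ?B = "transpose A ** S ** transpose S ** A - transpose A ** A"
  have adj: "u \<bullet> (transpose B *v v) = (B *v u) \<bullet> v" for B :: "real ^ 'm ^ 'n" and u v
    by (metis dot_lmul_matrix inner_commute transpose_matrix_vector)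
  have sq: "(\<Sum>i\<in>UNIV. (v \<bullet> column i S)\<^sup>2) = (norm (transpose S *v v))\<^sup>2" for v
    unfolding power2_norm_eq_inner
    by (simp add: inner_vec_def matrix_vector_mult_def transpose_def column_def
        power2_eq_square ac_simps del: transpose_matrix_vector)
  have "u \<bullet> (?B *v u) = u \<bullet> (transpose A *v (S *v (transpose S *v (A *v u)))) - u \<bullet> (transpose A *v (A *v u))"
    by (simp only: matrix_vector_mult_diff_rdistrib inner_diff_right matrix_vector_mul_assoc matrix_mul_assoc)
  also have "\<dots> = (norm (transpose S *v (A *v u)))\<^sup>2 - (norm (A *v u))\<^sup>2"
    using adj[of "A *v u" "transpose S" "transpose S *v (A *v u)"]
    by (simp only: adj transpose_transpose power2_norm_eq_inner)
  finally have "\<bar>(norm (transpose S *v (A *v u)))\<^sup>2 - (norm (A *v u))\<^sup>2\<bar> \<le> spectral_norm ?B * norm u * norm u"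
    using abs_inner_matrix_le[of u ?B u] by simp
  also have "\<dots> \<le> (\<gamma> * ((spectral_norm A)\<^sup>2 + (norm A)\<^sup>2 / k)) * norm u * norm u"
    using assms unfolding sketch_accurate_def by (intro mult_right_mono) auto
  finally show ?thesis unfolding sq by (simp add: power2_eq_square ac_simps)
qed

text \<open>The column itself is the test vector: its own term in the sum is the fourth power of its
  norm, which is thus at most a constant times the square. The quotient \<open>d / k\<close> comes
  from the squared Frobenius norm of the identity.\<close>

lemma sketch_column_bound:
  fixes S :: "real ^ 'l ^ 'd"
  assumes "sketch_accurate (1/4) k (mat 1) S" and k: "0 < k"
  shows "(norm (column i S))\<^sup>2 \<le> 5/4 + real CARD('d) / (4 * k)"
proof -
  let ?s = "column i S"
  have "((?s \<bullet> ?s)\<^sup>2) \<le> (\<Sum>j\<in>UNIV. (?s \<bullet> column j S)\<^sup>2)"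
    by (rule member_le_sum) auto
  also have "\<dots> \<le> (norm ?s)\<^sup>2 + 1/4 * ((spectral_norm (mat 1 :: real ^ 'd ^ 'd))\<^sup>2 + real CARD('d) / k) * (norm ?s)\<^sup>2"
    using abs_le_D1[OF sketch_accurate_form[OF assms(1), of ?s]]
    unfolding norm_mat_1_power2 matrix_vector_mul_lid by linarith
  also have "\<dots> \<le> (norm ?s)\<^sup>2 + 1/4 * (1 + real CARD('d) / k) * (norm ?s)\<^sup>2"
    using spectral_norm_mat_1_le
    by (intro add_left_mono mult_right_mono mult_left_mono add_right_mono power_le_one)
       (auto simp: spectral_norm_def onorm_pos_le)
  also have "\<dots> = (5/4 + real CARD('d) / (4 * k)) * (norm ?s)\<^sup>2"
    by (simp add: field_simps)
  finally have *: "(norm ?s)\<^sup>2 * (norm ?s)\<^sup>2 \<le> (5/4 + real CARD('d) / (4 * k)) * (norm ?s)\<^sup>2"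
    unfolding power2_norm_eq_inner by (simp only: power2_eq_square)
  show ?thesis
  proof (cases "?s = 0")
    case True
    then show ?thesis using k by simp
  next
    case False
    then show ?thesis using mult_right_le_imp_le[OF *] by simp
  qed
qed

text \<open>On the test vector \<open>g\<close> the rank-one matrix returns a multiple of
  \<open>g\<close>, so both sides share the factor \<open>?N * ?N\<close>, which cancels. The
  constant is 1/4 * (1 + 1/4), the inner 1/4 being the bound on 1/k.\<close>

lemma sketch_outer_prod_bound:
  fixes S :: "real ^ 'l ^ 'd"
  assumes "sketch_accurate (1/4) k (outer_prod g g) S" and k: "4 \<le> k"
  shows "\<bar>(\<Sum>i\<in>UNIV. (g \<bullet> column i S)\<^sup>2) - (norm g)\<^sup>2\<bar> \<le> 5/16 * (norm g)\<^sup>2"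
proof (cases "g = 0")
  case False
  let ?N = "(norm g)\<^sup>2"
  have "?N * ?N * \<bar>(\<Sum>i\<in>UNIV. (g \<bullet> column i S)\<^sup>2) - ?N\<bar>
      = \<bar>(\<Sum>i\<in>UNIV. ((outer_prod g g *v g) \<bullet> column i S)\<^sup>2) - (norm (outer_prod g g *v g))\<^sup>2\<bar>"
    by (simp add: outer_prod_mult_vec power_mult_distrib abs_mult power2_norm_eq_inner
        flip: sum_distrib_left right_diff_distrib)
       (simp add: power2_eq_square)
  also have "\<dots> \<le> 1/4 * ((spectral_norm (outer_prod g g))\<^sup>2 + (norm (outer_prod g g))\<^sup>2 / k) * ?N"
    by (rule sketch_accurate_form[OF assms(1)])
  also have "\<dots> \<le> 1/4 * ((norm (outer_prod g g))\<^sup>2 + (norm (outer_prod g g))\<^sup>2 / 4) * ?N"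
    using k by (intro mult_right_mono mult_left_mono add_mono power_mono spectral_norm_le_norm
        divide_left_mono) (auto simp: spectral_norm_def onorm_pos_le)
  also have "\<dots> = ?N * ?N * (5/16 * ?N)"
    by (simp add: norm_outer_prod power2_eq_square)
  finally show ?thesis using False by (simp add: mult_le_cancel_left)
qed simp

text \<open>Both sides of the defining inequality are continuous in the pair of matrices, so the set
  is closed and hence Borel.\<close>

lemma sets_sketch_accurate:
  "{p. sketch_accurate \<gamma> k (fst p :: real ^ 'd ^ 'd) (snd p :: real ^ 'l ^ 'd)} \<in> sets (borel \<Otimes>\<^sub>M borel)"
proof -
  have mult: "continuous_on UNIV (\<lambda>p. P p ** Q p)"
    if "continuous_on UNIV P" "continuous_on UNIV Q"
    for P :: "'p :: topological_space \<Rightarrow> real ^ 'n ^ 'm" and Q :: "'p \<Rightarrow> real ^ 'q ^ 'n"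
    unfolding matrix_matrix_mult_def by (intro continuous_intros that)
  have tr: "continuous_on UNIV (\<lambda>p. transpose (P p))" if "continuous_on UNIV P"
    for P :: "'p :: topological_space \<Rightarrow> real ^ 'n ^ 'm"
    unfolding transpose_def by (intro continuous_intros that)
  have sp: "continuous_on UNIV (\<lambda>p. spectral_norm (P p))" if "continuous_on UNIV P"
    for P :: "'p :: topological_space \<Rightarrow> real ^ 'n ^ 'm"
    using continuous_on_compose2[OF continuous_on_spectral_norm that] by simp
  have "closed {p. sketch_accurate \<gamma> k (fst p :: real ^ 'd ^ 'd) (snd p :: real ^ 'l ^ 'd)}"
    unfolding sketch_accurate_def divide_inverse
    by (intro closed_Collect_le sp mult tr continuous_intros)
  then show ?thesis unfolding borel_prod by (rule borel_closed)
qed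

section \<open>The empirical standard deviation\<close>

text \<open>The variance identity. The subtracted term is precisely the quantity that
  \<open>event_E3\<close> bounds when \<open>v\<close> lists the inner products with the
  columns.\<close>

lemma sum_centered_power2:
  fixes v :: "'i \<Rightarrow> real"
  assumes "finite A" "A \<noteq> {}"
  shows "(\<Sum>j\<in>A. (v j - 1 / real (card A) * sum v A)\<^sup>2)
           = (\<Sum>j\<in>A. (v j)\<^sup>2) - 1 / real (card A) * (sum v A)\<^sup>2"
proof -
  define m where "m = 1 / real (card A) * sum v A"
  have m: "real (card A) * m = sum v A" using assms by (simp add: m_def)
  have "(\<Sum>j\<in>A. (v j - m)\<^sup>2) = (\<Sum>j\<in>A. (v j)\<^sup>2) - 2 * m * sum v A + real (card A) * m * m"
    by (simp add: power2_diff sum.distrib sum_subtractf power2_eq_square[of m] mult_ac)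
       (simp flip: sum_distrib_left sum_distrib_right)
  also have "\<dots> = (\<Sum>j\<in>A. (v j)\<^sup>2) - m * sum v A" by (simp add: m)
  also have "m * sum v A = 1 / real (card A) * (sum v A)\<^sup>2"
    by (simp add: m_def power2_eq_square)
  finally show ?thesis by (simp add: m_def)
qed

text \<open>The remainders enter only through a bound \<open>R\<close> on their Euclidean length.
  The lower estimate splits a square with loss of a factor 2, whence 7/32 from 7/16; the upper one
  is Minkowski's inequality.\<close>

lemma zo_sigma_bounds:
  fixes F :: "real ^ 'd \<Rightarrow> 'z \<Rightarrow> real" and S :: "real ^ 'l ^ 'd" and g :: "real ^ 'd"
  assumes l: "CARD('l) \<ge> 2" and \<alpha>: "\<alpha> > 0" and R: "R \<ge> 0"
    and rem: "(\<Sum>i\<in>UNIV. (F (x + \<alpha> *\<^sub>R column i S) z - F x z - \<alpha> * (g \<bullet> column i S))\<^sup>2) \<le> R\<^sup>2"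
    and E3: "event_E3 g S"
    and sk: "\<bar>(\<Sum>i\<in>UNIV. (g \<bullet> column i S)\<^sup>2) - (norm g)\<^sup>2\<bar> \<le> 5/16 * (norm g)\<^sup>2"
  shows "7/32 * \<alpha>\<^sup>2 * (norm g)\<^sup>2 - R\<^sup>2 \<le> (real CARD('l) - 1) * (zo_sigma F \<alpha> x z S)\<^sup>2"
    and "sqrt (real CARD('l) - 1) * zo_sigma F \<alpha> x z S \<le> 3/2 * \<alpha> * norm g + R"
proof -
  define n where "n = real CARD('l)"
  have n: "n \<ge> 2" using l by (simp add: n_def)
  define a where "a i = g \<bullet> column i S" for i
  define r where "r i = F (x + \<alpha> *\<^sub>R column i S) z - F x z - \<alpha> * a i" for i
  define C where "C v j = v j - 1 / n * sum v UNIV" for v :: "'l \<Rightarrow> real" and j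
  have C: "(\<Sum>j\<in>UNIV. (C v j)\<^sup>2) = (\<Sum>j\<in>UNIV. (v j)\<^sup>2) - 1 / n * (sum v UNIV)\<^sup>2" for v
    unfolding C_def n_def by (rule sum_centered_power2) auto
  \<comment> \<open>Below, 7/16 is 1 - 5/16 - 1/4. Above, 21/16 is relaxed to 9/4, whose root is the
    3/2 of the conclusion.\<close>
  have Ca: "7/16 * (norm g)\<^sup>2 \<le> (\<Sum>j\<in>UNIV. (C a j)\<^sup>2)" "(\<Sum>j\<in>UNIV. (C a j)\<^sup>2) \<le> 9/4 * (norm g)\<^sup>2"
  proof -
    have "1 / n * (sum a UNIV)\<^sup>2 \<le> 1/4 * (norm g)\<^sup>2"
      using E3 unfolding event_E3_def n_def a_def .
    moreover have "0 \<le> 1 / n * (sum a UNIV)\<^sup>2" using n by simp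
    moreover have "11/16 * (norm g)\<^sup>2 \<le> (\<Sum>i\<in>UNIV. (a i)\<^sup>2)" "(\<Sum>i\<in>UNIV. (a i)\<^sup>2) \<le> 21/16 * (norm g)\<^sup>2"
      using sk unfolding a_def by linarith+
    ultimately show "7/16 * (norm g)\<^sup>2 \<le> (\<Sum>j\<in>UNIV. (C a j)\<^sup>2)" "(\<Sum>j\<in>UNIV. (C a j)\<^sup>2) \<le> 9/4 * (norm g)\<^sup>2"
      unfolding C using zero_le_power2[of "norm g"] by linarith+
  qed
  \<comment> \<open>Centring cannot lengthen a vector.\<close>
  have Cr: "(\<Sum>j\<in>UNIV. (C r j)\<^sup>2) \<le> R\<^sup>2"
  proof -
    have "0 \<le> 1 / n * (sum r UNIV)\<^sup>2" using n by simp
    then show ?thesis using rem unfolding C by (simp add: r_def a_def)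
  qed
  \<comment> \<open>The common value \<open>F x z\<close> equals its own mean and disappears under
    centring.\<close>
  have dev: "F (x + \<alpha> *\<^sub>R column j S) z - 1 / n * (\<Sum>i\<in>UNIV. F (x + \<alpha> *\<^sub>R column i S) z)
      = \<alpha> * C a j + C r j" for j
  proof -
    have F: "F (x + \<alpha> *\<^sub>R column i S) z = F x z + \<alpha> * a i + r i" for i by (simp add: r_def)
    have "1 / n * (\<Sum>i\<in>UNIV. F (x + \<alpha> *\<^sub>R column i S) z)
        = F x z + \<alpha> * (1 / n * sum a UNIV) + 1 / n * sum r UNIV"
      using n unfolding F by (simp add: sum.distrib sum_distrib_left[symmetric] n_def[symmetric] field_simps)
    then show ?thesis unfolding C_def F by (simp add: algebra_simps)
  qed
  let ?\<sigma> = "zo_sigma F \<alpha> x z S"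
  have \<sigma>: "?\<sigma> = sqrt (1 / (n - 1) * (\<Sum>j\<in>UNIV. (\<alpha> * C a j + C r j)\<^sup>2))"
    unfolding zo_sigma_def dev[symmetric] by (simp add: n_def)
  have \<sigma>2: "(n - 1) * ?\<sigma>\<^sup>2 = (\<Sum>j\<in>UNIV. (\<alpha> * C a j + C r j)\<^sup>2)"
    unfolding \<sigma> using n by (simp add: sum_nonneg)
  \<comment> \<open>The difference of the two sides is half the square of
    \<open>p + 2 * q\<close>.\<close>
  have half: "1/2 * p\<^sup>2 - q\<^sup>2 \<le> (p + q)\<^sup>2" for p q :: real
    using zero_le_power2[of "p + 2 * q"] by (simp add: power2_eq_square algebra_simps)
  have "7/32 * \<alpha>\<^sup>2 * (norm g)\<^sup>2 - R\<^sup>2 \<le> 1/2 * (\<alpha>\<^sup>2 * (\<Sum>j\<in>UNIV. (C a j)\<^sup>2)) - (\<Sum>j\<in>UNIV. (C r j)\<^sup>2)"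
    using mult_left_mono[OF Ca(1), of "\<alpha>\<^sup>2"] Cr by simp
  also have "\<dots> = (\<Sum>j\<in>UNIV. 1/2 * (\<alpha> * C a j)\<^sup>2 - (C r j)\<^sup>2)"
    by (simp add: sum_subtractf sum_distrib_left power_mult_distrib)
  also have "\<dots> \<le> (\<Sum>j\<in>UNIV. (\<alpha> * C a j + C r j)\<^sup>2)"
    by (intro sum_mono half)
  finally show "7/32 * \<alpha>\<^sup>2 * (norm g)\<^sup>2 - R\<^sup>2 \<le> (real CARD('l) - 1) * ?\<sigma>\<^sup>2"
    using \<sigma>2 by (simp add: n_def)
  have "sqrt (n - 1) * ?\<sigma> = L2_set (\<lambda>j. \<alpha> * C a j + C r j) UNIV"
    unfolding \<sigma> L2_set_def using n by (simp add: real_sqrt_divide)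
  also have "\<dots> \<le> L2_set (\<lambda>j. \<alpha> * C a j) UNIV + L2_set (C r) UNIV"
    by (rule L2_set_triangle_ineq)
  also have "\<dots> = \<alpha> * L2_set (C a) UNIV + L2_set (C r) UNIV"
    using \<alpha> by (simp add: L2_set_right_distrib)
  also have "L2_set (C a) UNIV \<le> 3/2 * norm g"
    unfolding L2_set_def using Ca(2) by (intro real_le_lsqrt) (auto simp: power_mult_distrib power2_eq_square sum_nonneg)
  also have "L2_set (C r) UNIV \<le> R"
    unfolding L2_set_def using Cr R by (intro real_le_lsqrt) (auto simp: sum_nonneg)
  finally show "sqrt (real CARD('l) - 1) * ?\<sigma> \<le> 3/2 * \<alpha> * norm g + R"
    using \<alpha> by (simp add: n_def ac_simps)
qed

section \<open>Taylor remainders in the ball and the role of \<open>\<beta>\<close>\<close>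

lemma convex_K_ball: "convex (K_ball x0 T L1 H k)"
proof -
  have "K_ball x0 T L1 H k = cball x0 (3 * sqrt (real T) / (350 * L1 * sqrt (zeta2 H k)))"
    unfolding K_ball_def cball_def by (simp add: dist_norm norm_minus_commute)
  then show ?thesis by simp
qed

text \<open>Convexity keeps the segment to each perturbed point inside \<open>K\<close>, where the
  Hessian bound holds; the column bound then controls each remainder.\<close>

lemma zo_remainder_bound:
  fixes f :: "real ^ 'd \<Rightarrow> real" and S :: "real ^ 'l ^ 'd"
  assumes K: "convex K" "x \<in> K" "\<And>i. x + \<alpha> *\<^sub>R column i S \<in> K"
    and f: "\<And>y. y \<in> K \<Longrightarrow> twice_differentiable_at f y \<and> spectral_norm (hessian f y) \<le> L"
    and L: "0 \<le> L" and k: "0 < k" and sk: "sketch_accurate (1/4) k (mat 1) S"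
  shows "(\<Sum>i\<in>UNIV. (f (x + \<alpha> *\<^sub>R column i S) - f x - \<alpha> * (grad f x \<bullet> column i S))\<^sup>2)
           \<le> L\<^sup>2 * \<alpha> ^ 4 / 4 * zeta1_hat (real CARD('d)) (real CARD('l)) k"
proof -
  define c where "c = 5/4 + real CARD('d) / (4 * k)"
  define l where "l = real CARD('l)"
  have c: "c \<ge> 0" using k by (simp add: c_def)
  have l: "l \<ge> 1" by (simp add: l_def)
  have "(f (x + \<alpha> *\<^sub>R column i S) - f x - \<alpha> * (grad f x \<bullet> column i S))\<^sup>2 \<le> L\<^sup>2 * \<alpha> ^ 4 / 4 * c\<^sup>2" for i
  proof -
    let ?v = "\<alpha> *\<^sub>R column i S"
    have seg: "x + s *\<^sub>R ?v \<in> K" if "0 \<le> s" "s \<le> 1" for s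
    proof -
      have "(1 - s) *\<^sub>R x + s *\<^sub>R (x + ?v) \<in> K"
        by (rule convexD[OF K(1,2) K(3)]) (use that in auto)
      then show ?thesis by (simp add: algebra_simps)
    qed
    have "\<bar>f (x + ?v) - f x - grad f x \<bullet> ?v\<bar> \<le> L / 2 * (norm ?v)\<^sup>2"
      by (rule second_order_taylor_bound) (use f seg in auto)
    also have "\<dots> = L / 2 * \<alpha>\<^sup>2 * (norm (column i S))\<^sup>2"
      by (simp add: power_mult_distrib)
    also have "\<dots> \<le> L / 2 * \<alpha>\<^sup>2 * c"
      unfolding c_def using L sketch_column_bound[OF sk k] by (intro mult_left_mono) auto
    finally have "\<bar>f (x + ?v) - f x - \<alpha> * (grad f x \<bullet> column i S)\<bar>\<^sup>2 \<le> (L / 2 * \<alpha>\<^sup>2 * c)\<^sup>2"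
      by (intro power_mono) auto
    then show ?thesis by (simp add: power_mult_distrib power_divide flip: power_mult)
  qed
  then have "(\<Sum>i\<in>UNIV. (f (x + \<alpha> *\<^sub>R column i S) - f x - \<alpha> * (grad f x \<bullet> column i S))\<^sup>2)
      \<le> (\<Sum>i\<in>(UNIV :: 'l set). L\<^sup>2 * \<alpha> ^ 4 / 4 * c\<^sup>2)"
    by (intro sum_mono)
  also have "\<dots> = L\<^sup>2 * \<alpha> ^ 4 / 4 * (l * c\<^sup>2)" by (simp add: l_def)
  \<comment> \<open>Replacing \<open>l\<close> by its square is a deliberate loss, made to reach
    \<open>zeta1_hat\<close>, the square of \<open>l * c\<close>.\<close>
  also have "\<dots> \<le> L\<^sup>2 * \<alpha> ^ 4 / 4 * (l\<^sup>2 * c\<^sup>2)"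
    using l by (intro mult_left_mono mult_right_mono self_le_power) auto
  also have "l\<^sup>2 * c\<^sup>2 = zeta1_hat (real CARD('d)) (real CARD('l)) k"
    unfolding zeta1_hat_def c_def l_def power_mult_distrib[symmetric] by (simp add: algebra_simps)
  finally show ?thesis .
qed

text \<open>The choice of \<open>\<beta>\<close> and the bound on \<open>\<alpha>\<close> are
  matched so that the squared remainder length is at most half of
  \<open>(l - 1) * \<beta>\<^sup>2\<close>. Adding \<open>\<beta>\<close> to \<open>\<sigma>\<close>
  therefore absorbs the remainder and leaves the other half.\<close>

lemma zo_sigma_two_sided:
  fixes F :: "real ^ 'd \<Rightarrow> 'z \<Rightarrow> real" and S :: "real ^ 'l ^ 'd" and g :: "real ^ 'd"
  defines "l \<equiv> real CARD('l)"
  assumes l2: "CARD('l) \<ge> 2" and \<alpha>: "\<alpha> > 0" and L: "L > 0" and \<nu>: "\<nu> > 0" and \<zeta>: "\<zeta> > 0"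
    and rem: "(\<Sum>i\<in>UNIV. (F (x + \<alpha> *\<^sub>R column i S) z - F x z - \<alpha> * (g \<bullet> column i S))\<^sup>2)
                \<le> L\<^sup>2 * \<alpha> ^ 4 / 4 * \<zeta>"
    and E3: "event_E3 g S"
    and sk: "\<bar>(\<Sum>i\<in>UNIV. (g \<bullet> column i S)\<^sup>2) - (norm g)\<^sup>2\<bar> \<le> 5/16 * (norm g)\<^sup>2"
    and \<beta>: "\<beta> = \<alpha> * \<nu> / (4 * sqrt (l - 1))"
    and \<alpha>_le: "\<alpha>\<^sup>2 \<le> \<nu>\<^sup>2 / (8 * L\<^sup>2 * \<zeta>)"
  shows "sqrt (\<alpha>\<^sup>2 / (8 * (l - 1)) * (norm g)\<^sup>2 + \<beta>\<^sup>2 / 2) \<le> zo_sigma F \<alpha> x z S + \<beta>"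
    and "zo_sigma F \<alpha> x z S \<le> 3 * \<alpha> / (2 * sqrt (l - 1)) * norm g
           + sqrt (3 * \<alpha> ^ 4 * L\<^sup>2 * \<zeta> / (4 * (l - 1)))"
proof -
  let ?\<sigma> = "zo_sigma F \<alpha> x z S"
  define q where "q = sqrt (l - 1)"
  have l: "l \<ge> 2" using l2 by (simp add: l_def)
  have q: "q > 0" "q\<^sup>2 = l - 1" using l by (simp_all add: q_def)
  define R where "R = L * \<alpha>\<^sup>2 * sqrt \<zeta> / 2"
  have R: "R \<ge> 0" "R\<^sup>2 = L\<^sup>2 * \<alpha> ^ 4 / 4 * \<zeta>"
    using L \<zeta> by (simp_all add: R_def power_mult_distrib power_divide flip: power_mult)
  note bounds = zo_sigma_bounds[where F = F and x = x and z = z and S = S and g = g, OF l2 \<alpha> R(1) rem[folded R(2)] E3 sk, folded l_def, folded q_def q(2)]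
  have \<sigma>: "0 \<le> ?\<sigma>" unfolding zo_sigma_def using l by (simp add: l_def sum_nonneg)
  have \<beta>0: "\<beta> > 0" using \<alpha> \<nu> q by (simp add: \<beta> flip: q_def)
  have q\<beta>: "q\<^sup>2 * \<beta>\<^sup>2 = \<alpha>\<^sup>2 * \<nu>\<^sup>2 / 16"
    using q(1) by (simp add: \<beta> power_divide power_mult_distrib flip: q_def)
  have "R\<^sup>2 \<le> q\<^sup>2 * \<beta>\<^sup>2 / 2"
  proof -
    have "\<alpha>\<^sup>2 * (8 * L\<^sup>2 * \<zeta>) \<le> \<nu>\<^sup>2"
      using \<alpha>_le L \<zeta> by (simp add: pos_le_divide_eq)
    from mult_left_mono[OF this, of "\<alpha>\<^sup>2"] show ?thesis
      unfolding R(2) q\<beta> by (simp add: power4_eq_xxxx power2_eq_square algebra_simps)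
  qed
  \<comment> \<open>Nonnegativity permits lowering the coefficient 7/32 to 1/8.\<close>
  moreover have "0 \<le> \<alpha>\<^sup>2 * (norm g)\<^sup>2" by simp
  moreover have "q\<^sup>2 * (\<alpha>\<^sup>2 / (8 * q\<^sup>2) * (norm g)\<^sup>2 + \<beta>\<^sup>2 / 2)
      = \<alpha>\<^sup>2 * (norm g)\<^sup>2 / 8 + q\<^sup>2 * \<beta>\<^sup>2 / 2"
    using q(1) by (simp add: distrib_left)
  ultimately have "q\<^sup>2 * (\<alpha>\<^sup>2 / (8 * q\<^sup>2) * (norm g)\<^sup>2 + \<beta>\<^sup>2 / 2) \<le> q\<^sup>2 * ?\<sigma>\<^sup>2 + q\<^sup>2 * \<beta>\<^sup>2"
    using bounds(1) unfolding mult.assoc by linarith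
  \<comment> \<open>The cross term of the square is nonnegative.\<close>
  also have "\<dots> \<le> q\<^sup>2 * (?\<sigma> + \<beta>)\<^sup>2"
    using \<sigma> \<beta>0 by (simp add: power2_sum algebra_simps)
  finally have "\<alpha>\<^sup>2 / (8 * q\<^sup>2) * (norm g)\<^sup>2 + \<beta>\<^sup>2 / 2 \<le> (?\<sigma> + \<beta>)\<^sup>2"
    using q(1) by (simp add: mult_le_cancel_left)
  then show "sqrt (\<alpha>\<^sup>2 / (8 * (l - 1)) * (norm g)\<^sup>2 + \<beta>\<^sup>2 / 2) \<le> ?\<sigma> + \<beta>"
    unfolding q(2)[symmetric] using \<sigma> \<beta>0 by (intro real_le_lsqrt) auto
  have "?\<sigma> \<le> (3/2 * \<alpha> * norm g + R) / q"
    using bounds(2) q(1) by (simp add: pos_le_divide_eq mult.commute)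
  also have "\<dots> = 3 * \<alpha> / (2 * q) * norm g + R / q"
    by (simp add: add_divide_distrib)
  \<comment> \<open>The square of \<open>R / q\<close> has coefficient 1/4; the stated bound allows
    3/4.\<close>
  also have "R / q \<le> sqrt (3 * \<alpha> ^ 4 * L\<^sup>2 * \<zeta> / (4 * q\<^sup>2))"
  proof (rule real_le_rsqrt)
    have "0 \<le> L\<^sup>2 * \<alpha> ^ 4 * \<zeta>" using \<zeta> by simp
    then show "(R / q)\<^sup>2 \<le> 3 * \<alpha> ^ 4 * L\<^sup>2 * \<zeta> / (4 * q\<^sup>2)"
      using q(1) by (simp add: power_divide R(2) divide_simps) (simp add: algebra_simps)
  qed
  finally show "?\<sigma> \<le> 3 * \<alpha> / (2 * sqrt (l - 1)) * norm g + sqrt (3 * \<alpha> ^ 4 * L\<^sup>2 * \<zeta> / (4 * (l - 1)))"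
    by (simp add: q_def[symmetric] q(2))
qed

section \<open>Probability of accurate sketching and the final bounds\<close>

text \<open>Conditioning is expressed pointwise: the inequalities hold at every outcome in the three
  events. The loss of \<open>2 * \<delta>\<close> pays for two accuracy requirements, one for the
  identity and one for the gradient matrix. \<open>In_K\<close> puts the iterate and its
  perturbations where the Hessian bound is available.\<close>

theorem lemma21:
  fixes M :: "'w measure" and D :: "'z measure"
    and F :: "real ^ 'd \<Rightarrow> 'z \<Rightarrow> real" and f :: "real ^ 'd \<Rightarrow> real"
    and H :: "real ^ 'd ^ 'd" and x0 :: "real ^ 'd"
    and \<xi> :: "nat \<Rightarrow> 'w \<Rightarrow> 'z" and S :: "nat \<Rightarrow> 'w \<Rightarrow> real ^ 'l ^ 'd"
    and L0 L1 L\<^sub>h \<nu> k \<delta> \<alpha> \<beta> \<eta> :: real and t T :: nat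
  defines "d \<equiv> real CARD('d)" and "l \<equiv> real CARD('l)"
  defines "x \<equiv> \<lambda>w. zo_iterate F \<alpha> \<beta> \<eta> x0 (\<lambda>i. \<xi> i w) (\<lambda>i. S i w) t"
  defines "g \<equiv> \<lambda>w. grad (\<lambda>y. F y (\<xi> t w)) (x w)"
  defines "\<sigma> \<equiv> \<lambda>w. zo_sigma F \<alpha> (x w) (\<xi> t w) (S t w)"
  defines "Sketch_OK \<equiv> {w \<in> space M. sketch_accurate (1/4) k (mat 1) (S t w) \<and>
                                     sketch_accurate (1/4) k (outer_prod (g w) (g w)) (S t w)}"
  defines "In_K \<equiv> {w \<in> space M. x w \<in> K_ball x0 T L1 H k \<and>
                                (\<forall>i. x w + \<alpha> *\<^sub>R column i (S t w) \<in> K_ball x0 T L1 H k)}"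
  defines "E3 \<equiv> {w \<in> space M. event_E3 (g w) (S t w)}"
  assumes "prob_space M" and "prob_space D"
    and integrable: "\<And>y. integrable D (F y)"
    and expectation: "\<And>y. f y = (LINT z|D. F y z)"
    and f_diff: "\<And>y. f differentiable (at y)"
    and H_psd: "pos_semidef H"
    and L0: "L0 \<ge> 0" and L1: "L1 > 0"
    and smooth: "L0_L1_smooth L0 L1 H f"
    and F_diff: "\<And>y z. z \<in> space D \<Longrightarrow> (\<lambda>u. F u z) differentiable (at y)"
    and Lh: "L\<^sub>h > 0"
    and F_twice_diff: "\<And>y z. z \<in> space D \<Longrightarrow> y \<in> K_ball x0 T L1 H k \<Longrightarrow>
           twice_differentiable_at (\<lambda>u. F u z) y \<and> spectral_norm (hessian (\<lambda>u. F u z) y) \<le> L\<^sub>h"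
    and \<nu>: "\<nu> > 0"
    and noise: "\<And>y z. z \<in> space D \<Longrightarrow> norm (grad (\<lambda>u. F u z) y - grad f y) \<le> \<nu>"
    and t: "t < T"
    and \<xi>_law: "\<xi> t \<in> measurable M D" "distr M D (\<xi> t) = D"
    and S_indep: "indep_rv M (borel \<Otimes>\<^sub>M D) (\<lambda>w. (x w, \<xi> t w)) borel (S t)"
    and sketch: "oblivious_sketching M (1/4) k \<delta> (S t)"
    and k: "k \<ge> 4" and \<delta>: "0 < \<delta>" "\<delta> < 1"
    and l: "CARD('l) \<ge> 2"
    and \<alpha>: "\<alpha> > 0" and \<eta>: "\<eta> > 0"
    and \<beta>: "\<beta> = \<alpha> * \<nu> / (4 * sqrt (l - 1))"
    and \<alpha>_le: "\<alpha>\<^sup>2 \<le> \<nu>\<^sup>2 / (8 * L\<^sub>h\<^sup>2 * zeta1_hat d l k)"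
  shows "Sketch_OK \<in> sets M \<and> measure M Sketch_OK \<ge> 1 - 2 * \<delta> \<and>
         (\<forall>w \<in> Sketch_OK \<inter> In_K \<inter> E3.
            \<sigma> w + \<beta> \<ge> sqrt (\<alpha>\<^sup>2 / (8 * (l - 1)) * (norm (g w))\<^sup>2 + \<beta>\<^sup>2 / 2) \<and>
            \<sigma> w \<le> 3 * \<alpha> / (2 * sqrt (l - 1)) * norm (g w)
                    + sqrt (3 * \<alpha> ^ 4 * L\<^sub>h\<^sup>2 * zeta1_hat d l k / (4 * (l - 1))))"
proof -
  interpret prob_space M by fact
  let ?N = "borel \<Otimes>\<^sub>M D"
  \<comment> \<open>The gradient as a function of the pair of iterate and sample, which is the pair
    that \<open>S_indep\<close> makes independent of \<open>S t\<close>.\<close>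
  define G where "G p = grad (\<lambda>u. F u (snd p)) (fst p)" for p
  have g_G: "g w = G (x w, \<xi> t w)" for w by (simp add: g_def G_def)
  have X: "(\<lambda>w. (x w, \<xi> t w)) \<in> measurable M ?N" and S: "S t \<in> borel_measurable M"
    using S_indep unfolding indep_rv_def by auto
  have F_meas: "F y \<in> borel_measurable D" for y
    using integrable by (rule borel_measurable_integrable)
  have G: "G \<in> borel_measurable ?N"
    unfolding G_def by (rule measurable_grad[OF measurable_fst measurable_snd F_meas F_diff])
  have "continuous_on UNIV (\<lambda>v :: real ^ 'd. outer_prod v v)"
    unfolding outer_prod_def by (intro continuous_intros)
  then have GG: "(\<lambda>p. outer_prod (G p) (G p)) \<in> borel_measurable ?N"
    using G by (rule borel_measurable_continuous_on)

  let ?sk = "{p. sketch_accurate (1/4) k (fst p :: real ^ 'd ^ 'd) (snd p :: real ^ 'l ^ 'd)}"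
  define Q where "Q = (\<lambda>p. (outer_prod (G (fst p)) (G (fst p)), snd p)) -` ?sk
    \<inter> space (?N \<Otimes>\<^sub>M (borel :: (real ^ 'l ^ 'd) measure))"
  have Q: "Q \<in> sets (?N \<Otimes>\<^sub>M borel)"
    unfolding Q_def
    by (rule measurable_sets[OF _ sets_sketch_accurate])
       (intro measurable_Pair measurable_compose[OF measurable_fst GG] measurable_snd)
  have Q_iff: "(p, s) \<in> Q \<longleftrightarrow> sketch_accurate (1/4) k (outer_prod (G p) (G p)) s"
    if "p \<in> space ?N" for p s
    using that by (simp add: Q_def space_pair_measure)

  let ?A = "{w \<in> space M. sketch_accurate (1/4) k (mat 1 :: real ^ 'd ^ 'd) (S t w)}"
  let ?B = "{w \<in> space M. ((x w, \<xi> t w), S t w) \<in> Q}"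
  have OK: "Sketch_OK = ?A \<inter> ?B"
    unfolding Sketch_OK_def g_G using measurable_space[OF X] by (auto simp: Q_iff)
  have A: "?A \<in> sets M"
  proof -
    have "(\<lambda>w. (mat 1 :: real ^ 'd ^ 'd, S t w)) \<in> measurable M (borel \<Otimes>\<^sub>M borel)"
      using S by measurable
    from measurable_sets[OF this sets_sketch_accurate] show ?thesis
      by (simp add: vimage_def Int_def conj_commute)
  qed
  have B: "?B \<in> sets M"
  proof -
    have "(\<lambda>w. ((x w, \<xi> t w), S t w)) \<in> measurable M (?N \<Otimes>\<^sub>M borel)"
      using X S by (rule measurable_Pair)
    from measurable_sets[OF this Q] show ?thesis
      by (simp add: vimage_def Int_def conj_commute)
  qed
  have sk: "1 - \<delta> \<le> measure M {w \<in> space M. sketch_accurate (1/4) k (C :: real ^ 'd ^ 'd) (S t w)}" for C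
    using sketch unfolding oblivious_sketching_def by blast
  \<comment> \<open>For a frozen pair the gradient matrix is deterministic, so obliviousness
    applies.\<close>
  have "1 - \<delta> \<le> measure M ?B"
    by (rule indep_rv_measure_ge[OF \<open>prob_space M\<close> S_indep Q]) (simp add: Q_iff sk)
  \<comment> \<open>Inclusion-exclusion with a union of probability at most 1 bounds the
    intersection; \<open>?A\<close> and \<open>?B\<close> need not be independent.\<close>
  moreover have "measure M (?A \<union> ?B) = measure M ?A + measure M ?B - measure M (?A \<inter> ?B)"
    using A B by (intro measure_Un3) (auto simp: fmeasurable_eq_sets)
  ultimately have prob_OK: "1 - 2 * \<delta> \<le> measure M Sketch_OK"
    using sk[of "mat 1"] prob_le_1[of "?A \<union> ?B"] unfolding OK by linarith

  \<comment> \<open>Positivity makes the quotient in \<open>\<alpha>_le\<close> a genuine one, so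
    its denominator can be cleared.\<close>
  have \<zeta>: "zeta1_hat d l k > 0"
    using k unfolding zeta1_hat_def d_def l_def
    by (intro zero_less_power add_pos_nonneg) auto
  have "sqrt (\<alpha>\<^sup>2 / (8 * (l - 1)) * (norm (g w))\<^sup>2 + \<beta>\<^sup>2 / 2) \<le> \<sigma> w + \<beta> \<and>
      \<sigma> w \<le> 3 * \<alpha> / (2 * sqrt (l - 1)) * norm (g w) + sqrt (3 * \<alpha> ^ 4 * L\<^sub>h\<^sup>2 * zeta1_hat d l k / (4 * (l - 1)))"
    if w: "w \<in> Sketch_OK \<inter> In_K \<inter> E3" for w
  proof -
    have z: "\<xi> t w \<in> space D"
      using w measurable_space[OF \<xi>_law(1)] by (auto simp: In_K_def)
    have ok: "sketch_accurate (1/4) k (mat 1 :: real ^ 'd ^ 'd) (S t w)"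
      "sketch_accurate (1/4) k (outer_prod (g w) (g w)) (S t w)"
      using w by (auto simp: Sketch_OK_def)
    have rem: "(\<Sum>i\<in>UNIV. (F (x w + \<alpha> *\<^sub>R column i (S t w)) (\<xi> t w) - F (x w) (\<xi> t w)
          - \<alpha> * (g w \<bullet> column i (S t w)))\<^sup>2) \<le> L\<^sub>h\<^sup>2 * \<alpha> ^ 4 / 4 * zeta1_hat d l k"
      unfolding g_def d_def l_def
      by (rule zo_remainder_bound[OF convex_K_ball _ _ F_twice_diff[OF z] _ _ ok(1)])
         (use w Lh k in \<open>auto simp: In_K_def\<close>)
    have E: "event_E3 (g w) (S t w)" using w by (simp add: E3_def)
    show ?thesis
      unfolding \<sigma>_def l_def
      using zo_sigma_two_sided[where F = F and x = "x w" and z = "\<xi> t w" and S = "S t w" and g = "g w",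
          OF l \<alpha> Lh \<nu> \<zeta> rem E sketch_outer_prod_bound[OF ok(2) k]
          \<beta>[unfolded l_def] \<alpha>_le]
      by (simp add: l_def)
  qed
  then show ?thesis using A B prob_OK by (auto simp: OK)
qed

end
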